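(* Let $d\in\mathbb{N}$, let $U\subset\mathbb{R}^d$, let $V\subset\mathbb{R}^d$ be a Delone set, and let $f:U\to V$ be a Lipschitz bijection. Then $f$ is pointwise co-Lipschitz if and only if $f$ is co-homogeneous.
   Context: $\mathbb{N}=\{1,2,\dots\}$, $\|\cdot\|$ is the Euclidean norm, $B(0,R)$ is the open ball of radius $R$ centred at $0$. A set $V\subset\mathbb{R}^d$ is a Delone set if there is $s>0$ such that every closed ball of radius $s$ in $\mathbb{R}^d$ contains at most one point of $V$, and there is $S>0$ such that every closed ball of radius $S$ in $\mathbb{R}^d$ contains at least one point of $V$. A bijection $f:U\to V$ is pointwise co-Lipschitz if for every $v\in V$ there is $L=L(v)>0$ with $\|f^{-1}(w)-f^{-1}(v)\|\le L\|w-v\|$ for every $w\in V$. It is co-homogeneous if there are a non-decreasing function $\omega:[0,2)\to[0,\infty)$ with $\omega(0)=0$ and a constant $c>0$ such that for each $R>0$, $\|f^{-1}(x)-f^{-1}(y)\|\le cR\,\omega\left(\frac{\|x-y\|}{R}\right)$ whenever $x,y\in B(0,R)\cap V$. *)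

theory Defs
  imports "HOL-Analysis.Analysis"
begin

definition delone_set :: "(real ^ 'n) set \<Rightarrow> bool" where
  "delone_set V \<longleftrightarrow>
     (\<exists>s>0. \<forall>x. \<forall>p \<in> V \<inter> cball x s. \<forall>q \<in> V \<inter> cball x s. p = q) \<and>
     (\<exists>S>0. \<forall>x. V \<inter> cball x S \<noteq> {})"

text \<open>A map from \<open>U\<close> to \<open>V\<close> is a total function of which only the values on \<open>U\<close> matter;
  for a bijection, its inverse on \<open>V\<close> is \<open>inv_into U f\<close>. Both notions below presuppose
  that \<open>f\<close> is a bijection.\<close>

definition pointwise_co_lipschitz ::
  "(real ^ 'n) set \<Rightarrow> (real ^ 'n) set \<Rightarrow> (real ^ 'n \<Rightarrow> real ^ 'n) \<Rightarrow> bool" where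
  "pointwise_co_lipschitz U V f \<longleftrightarrow>
     (\<forall>v\<in>V. \<exists>L>0. \<forall>w\<in>V. norm (inv_into U f w - inv_into U f v) \<le> L * norm (w - v))"

text \<open>Only the values of \<open>\<omega>\<close> on \<open>[0,2)\<close> are used: \<open>norm (x - y) / R < 2\<close>
  for \<open>x, y\<close> in the open ball of radius \<open>R\<close>.\<close>

definition co_homogeneous ::
  "(real ^ 'n) set \<Rightarrow> (real ^ 'n) set \<Rightarrow> (real ^ 'n \<Rightarrow> real ^ 'n) \<Rightarrow> bool" where
  "co_homogeneous U V f \<longleftrightarrow>
     (\<exists>(\<omega> :: real \<Rightarrow> real) c.
        \<omega> ` {0..<2} \<subseteq> {0..} \<and> mono_on {0..<2} \<omega> \<and> \<omega> 0 = 0 \<and> c > 0 \<and>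
        (\<forall>R>0. \<forall>x \<in> ball 0 R \<inter> V. \<forall>y \<in> ball 0 R \<inter> V.
           norm (inv_into U f x - inv_into U f y) \<le> c * R * \<omega> (norm (x - y) / R)))"

end

theory Submission
  imports Defs
begin

text \<open>Since \<open>\<omega>\<close> need not be continuous at \<open>0\<close>, co-homogeneity only says that the inverse maps
  the points of \<open>V\<close> in a ball of radius \<open>R\<close> to a set of diameter \<open>O(R)\<close>. A co-Lipschitz bound
  at one point gives this, because a ball with two points of \<open>V\<close> cannot be small;
  conversely, for fixed \<open>v\<close> the radius \<open>\<parallel>v\<parallel> + \<parallel>w\<parallel> + 1\<close> is \<open>O(\<parallel>w - v\<parallel>)\<close>
  by the separation of \<open>V\<close>.\<close>

text \<open>Two points at distance at most \<open>s\<close> would both lie in the closed ball of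
  radius \<open>s\<close> centred at one of them.\<close>

lemma delone_set_separated:
  assumes "delone_set V"
  obtains s where "s > 0" and "\<And>p q. p \<in> V \<Longrightarrow> q \<in> V \<Longrightarrow> p \<noteq> q \<Longrightarrow> s < norm (p - q)"
proof -
  from assms obtain s where "s > 0"
    and s: "\<And>x p q. p \<in> V \<inter> cball x s \<Longrightarrow> q \<in> V \<inter> cball x s \<Longrightarrow> p = q"
    unfolding delone_set_def by metis
  have "s < norm (p - q)" if "p \<in> V" "q \<in> V" "p \<noteq> q" for p q
    using s[of p p q] that \<open>s > 0\<close> by (force simp: dist_norm)
  with \<open>s > 0\<close> show ?thesis by (rule that)
qed

lemma delone_set_nonempty: "delone_set V \<Longrightarrow> V \<noteq> {}"
  unfolding delone_set_def by blast

lemma pointwise_co_lipschitz_imp_co_homogeneous: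
  assumes "delone_set V" and "pointwise_co_lipschitz U V f"
  shows "co_homogeneous U V f"
proof -
  let ?g = "inv_into U f"
  obtain s where "s > 0" and s: "\<And>p q. p \<in> V \<Longrightarrow> q \<in> V \<Longrightarrow> p \<noteq> q \<Longrightarrow> s < norm (p - q)"
    using delone_set_separated[OF assms(1)] by blast
  obtain v where "v \<in> V"
    using delone_set_nonempty[OF assms(1)] by blast
  then obtain L where "L > 0" and L: "\<And>w. w \<in> V \<Longrightarrow> norm (?g w - ?g v) \<le> L * norm (w - v)"
    using assms(2) unfolding pointwise_co_lipschitz_def by blast
  \<comment> \<open>The factor 2 comes from comparing both \<open>x\<close> and \<open>y\<close>
    with \<open>v\<close>; the bracket bounds \<open>(R + norm v) / R\<close> as soon as
    \<open>s < 2 * R\<close>.\<close>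
  define c where "c = 2 * L * (1 + 2 * norm v / s)"
  \<comment> \<open>The jump at 0 makes the required estimate trivial for \<open>x = y\<close> and
    turns it into the diameter bound \<open>c * R\<close> for \<open>x \<noteq> y\<close>.\<close>
  define \<omega> :: "real \<Rightarrow> real" where "\<omega> t = (if t > 0 then 1 else 0)" for t
  have "c > 0"
    using \<open>L > 0\<close> \<open>s > 0\<close> unfolding c_def by (auto intro!: mult_pos_pos add_pos_nonneg)
  have bound: "norm (?g x - ?g y) \<le> c * R * \<omega> (norm (x - y) / R)"
    if "R > 0" "x \<in> ball 0 R \<inter> V" "y \<in> ball 0 R \<inter> V" for R x y
  proof (cases "x = y")
    case True
    then show ?thesis by (simp add: \<omega>_def)
  next
    case False
    \<comment> \<open>This lower bound on \<open>R\<close> lets the fixed quantity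
      \<open>norm v\<close> be absorbed into a multiple of \<open>R\<close>.\<close>
    have "s < 2 * R"
      using s[of x y] False that norm_triangle_ineq4[of x y] by auto
    then have "norm v * s \<le> norm v * (2 * R)"
      by (intro mult_left_mono) auto
    then have v: "norm v \<le> 2 * norm v / s * R"
      using \<open>s > 0\<close> by (simp add: field_simps)
    \<comment> \<open>The base point \<open>v\<close> may lie outside the ball, hence the extra
      \<open>norm v\<close>.\<close>
    have near: "norm (?g w - ?g v) \<le> L * (R + norm v)" if "w \<in> ball 0 R \<inter> V" for w
    proof -
      have "norm (w - v) \<le> R + norm v"
        using that norm_triangle_ineq4[of w v] by auto
      then have "L * norm (w - v) \<le> L * (R + norm v)"
        using \<open>L > 0\<close> by simp
      then show ?thesis using L[of w] that by auto
    qed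
    have "norm (?g x - ?g y) \<le> norm (?g x - ?g v) + norm (?g y - ?g v)"
      using norm_triangle_ineq4[of "?g x - ?g v" "?g y - ?g v"] by simp
    also have "\<dots> \<le> 2 * L * (R + norm v)"
      using near[OF that(2)] near[OF that(3)] by linarith
    also have "\<dots> \<le> 2 * L * (R + 2 * norm v / s * R)"
      using v \<open>L > 0\<close> by (intro mult_left_mono add_left_mono) auto
    also have "\<dots> = c * R"
      by (simp add: c_def algebra_simps)
    also have "\<dots> = c * R * \<omega> (norm (x - y) / R)"
      using False \<open>R > 0\<close> by (simp add: \<omega>_def)
    finally show ?thesis .
  qed
  show ?thesis
    unfolding co_homogeneous_def
  proof (intro exI conjI allI impI ballI)
    show "\<omega> ` {0..<2} \<subseteq> {0..}" by (auto simp: \<omega>_def)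
    show "mono_on {0..<2} \<omega>" by (auto simp: mono_on_def \<omega>_def)
    show "\<omega> 0 = 0" by (simp add: \<omega>_def)
  qed (use \<open>c > 0\<close> bound in auto)
qed

lemma co_homogeneous_imp_pointwise_co_lipschitz:
  assumes "delone_set V" and "co_homogeneous U V f"
  shows "pointwise_co_lipschitz U V f"
  unfolding pointwise_co_lipschitz_def
proof
  let ?g = "inv_into U f"
  fix v assume "v \<in> V"
  obtain s where "s > 0" and s: "\<And>p q. p \<in> V \<Longrightarrow> q \<in> V \<Longrightarrow> p \<noteq> q \<Longrightarrow> s < norm (p - q)"
    using delone_set_separated[OF assms(1)] by blast
  obtain \<omega> :: "real \<Rightarrow> real" and c where "\<omega> ` {0..<2} \<subseteq> {0..}" and mono: "mono_on {0..<2} \<omega>"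
    and "c > 0"
    and \<omega>: "\<And>R x y. R > 0 \<Longrightarrow> x \<in> ball 0 R \<inter> V \<Longrightarrow> y \<in> ball 0 R \<inter> V \<Longrightarrow>
      norm (?g x - ?g y) \<le> c * R * \<omega> (norm (x - y) / R)"
    using assms(2) unfolding co_homogeneous_def by blast
  then have "\<omega> 1 \<ge> 0" by (auto simp: image_subset_iff)
  \<comment> \<open>Chosen so that \<open>R \<le> K * norm (w - v)\<close> for the radius
    \<open>R\<close> below: \<open>R\<close> exceeds \<open>norm (w - v)\<close> by at most
    \<open>2 * norm v + 1\<close>, and \<open>norm (w - v) / s > 1\<close> for
    \<open>w \<noteq> v\<close>.\<close>
  define K where "K = 1 + (2 * norm v + 1) / s"
  have "K > 0"
    using \<open>s > 0\<close> unfolding K_def by (auto intro!: add_pos_nonneg)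
  \<comment> \<open>Only \<open>\<omega> 1 \<ge> 0\<close> is at hand, so 1 is added to make the
    Lipschitz constant positive.\<close>
  have "norm (?g w - ?g v) \<le> c * K * (\<omega> 1 + 1) * norm (w - v)" if "w \<in> V" for w
  proof (cases "w = v")
    case False
    \<comment> \<open>The summand 1 puts both points into the open ball even if one of them is 0. As
      \<open>R \<ge> norm (w - v)\<close>, the argument of \<omega> is at most 1, and monotonicity
      bounds its value independently of \<open>w\<close>.\<close>
    define R where "R = norm v + norm w + 1"
    have "R > 0" and "norm (w - v) \<le> R"
      using norm_triangle_ineq4[of w v] unfolding R_def by (auto intro: add_nonneg_pos)
    then have "\<omega> (norm (w - v) / R) \<le> \<omega> 1"
      by (intro mono_onD[OF mono]) (auto simp: field_simps)
    have "w \<in> ball 0 R \<inter> V" "v \<in> ball 0 R \<inter> V"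
      using that \<open>v \<in> V\<close> norm_ge_zero[of v] norm_ge_zero[of w] unfolding R_def mem_ball_0 Int_iff
      by linarith+
    then have "norm (?g w - ?g v) \<le> c * R * \<omega> (norm (w - v) / R)"
      using \<omega> \<open>R > 0\<close> by blast
    also have "\<dots> \<le> c * R * (\<omega> 1 + 1)"
      using \<open>\<omega> (norm (w - v) / R) \<le> \<omega> 1\<close> \<open>c > 0\<close> \<open>R > 0\<close> by (intro mult_left_mono) auto
    also have "\<dots> \<le> c * (K * norm (w - v)) * (\<omega> 1 + 1)"
    proof -
      have "(2 * norm v + 1) * s \<le> (2 * norm v + 1) * norm (w - v)"
        using s[OF that \<open>v \<in> V\<close> False] by (intro mult_left_mono) auto
      then have "2 * norm v + 1 \<le> (2 * norm v + 1) / s * norm (w - v)"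
        using \<open>s > 0\<close> by (simp add: field_simps)
      moreover have "R \<le> norm (w - v) + (2 * norm v + 1)"
        using norm_triangle_sub[of w v] unfolding R_def by simp
      ultimately have "R \<le> K * norm (w - v)"
        by (simp add: K_def distrib_right)
      then show ?thesis
        using \<open>c > 0\<close> \<open>\<omega> 1 \<ge> 0\<close> by (intro mult_right_mono mult_left_mono) auto
    qed
    finally show ?thesis by (simp add: mult_ac)
  qed simp
  moreover have "c * K * (\<omega> 1 + 1) > 0"
    using \<open>c > 0\<close> \<open>K > 0\<close> \<open>\<omega> 1 \<ge> 0\<close> by (intro mult_pos_pos) auto
  ultimately show "\<exists>L>0. \<forall>w\<in>V. norm (?g w - ?g v) \<le> L * norm (w - v)"
    by blast
qed

theorem corollary2p5:
  fixes U V :: "(real ^ 'n) set" and f :: "real ^ 'n \<Rightarrow> real ^ 'n"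
  assumes "delone_set V"
    and "\<exists>L. L-lipschitz_on U f"
    and "bij_betw f U V"
  shows "pointwise_co_lipschitz U V f \<longleftrightarrow> co_homogeneous U V f"
  using pointwise_co_lipschitz_imp_co_homogeneous co_homogeneous_imp_pointwise_co_lipschitz assms(1)
  by blast

end
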